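(* If a finite simple graph $G$ is connected and trivially perfect, then $\alpha'(G)=\theta_e(G)$.
   Context: A graph is trivially perfect if it contains neither the cycle $C_4$ nor the path $P_4$ as an induced subgraph. A set $A$ of edges of $G$ is independent if no two edges of $A$ are contained in a common clique of $G$; $\alpha'(G)$ is the maximum cardinality of an independent set of edges (with $\alpha'(G)=0$ when $G$ has no edges). An edge-clique covering of $G$ is a family of complete subgraphs such that each edge of $G$ lies in at least one member; $\theta_e(G)$ is the minimum cardinality of such a family. *)

theory Defs
  imports "Graph_Theory.Graph_Theory"
begin

text \<open>
  As in the library, a finite simple graph is a symmetric, loop-free digraph without parallel
  arcs (locale \<^locale>\<open>graph\<close>). Each undirected edge is represented by two opposite arcs, so edges
  have to be counted as unordered pairs of end vertices.
\<close>

definition uedges :: "('a, 'b) pre_digraph \<Rightarrow> 'a set set" where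
  "uedges G = {{u, v} |u v. u \<rightarrow>\<^bsub>G\<^esub> v}"

definition path_graph :: "nat \<Rightarrow> nat pair_pre_digraph" where
  "path_graph n = \<lparr> pverts = {..<n},
     parcs = {(i, j). i < n \<and> j < n \<and> (j = Suc i \<or> i = Suc j)} \<rparr>"

text \<open>The cycle on \<open>n\<close> vertices; meaningful for \<open>n \<ge> 3\<close>.\<close>

definition cycle_graph :: "nat \<Rightarrow> nat pair_pre_digraph" where
  "cycle_graph n = \<lparr> pverts = {..<n},
     parcs = {(i, j). i < n \<and> j < n \<and> (j = Suc i mod n \<or> i = Suc j mod n)} \<rparr>"

definition contains_induced :: "('a, 'b) pre_digraph \<Rightarrow> ('c, 'd) pre_digraph \<Rightarrow> bool" where
  "contains_induced G F \<longleftrightarrow> (\<exists>H. induced_subgraph H G \<and> digraph_iso H F)"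

definition trivially_perfect :: "('a, 'b) pre_digraph \<Rightarrow> bool" where
  "trivially_perfect G \<longleftrightarrow>
     \<not> contains_induced G (with_proj (cycle_graph 4)) \<and>
     \<not> contains_induced G (with_proj (path_graph 4))"

text \<open>Cliques are taken to be complete subgraphs, not necessarily maximal ones.\<close>

definition complete_subgraph :: "('a, 'b) pre_digraph \<Rightarrow> ('a, 'b) pre_digraph \<Rightarrow> bool" where
  "complete_subgraph H G \<longleftrightarrow> subgraph H G \<and> complete_digraph (card (verts H)) H"

definition independent_edges :: "('a, 'b) pre_digraph \<Rightarrow> 'a set set \<Rightarrow> bool" where
  "independent_edges G A \<longleftrightarrow> A \<subseteq> uedges G \<and>
     (\<forall>e\<in>A. \<forall>f\<in>A. e \<noteq> f \<longrightarrow>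
        \<not> (\<exists>H. complete_subgraph H G \<and> e \<in> uedges H \<and> f \<in> uedges H))"

definition alpha_edge :: "('a, 'b) pre_digraph \<Rightarrow> nat" where
  "alpha_edge G = Max {card A |A. independent_edges G A}"

definition edge_clique_covering ::
    "('a, 'b) pre_digraph \<Rightarrow> ('a, 'b) pre_digraph set \<Rightarrow> bool" where
  "edge_clique_covering G C \<longleftrightarrow>
     (\<forall>H\<in>C. complete_subgraph H G) \<and> (\<forall>e\<in>uedges G. \<exists>H\<in>C. e \<in> uedges H)"

definition theta_edge :: "('a, 'b) pre_digraph \<Rightarrow> nat" where
  "theta_edge G = (LEAST n. \<exists>C. finite C \<and> card C = n \<and> edge_clique_covering G C)"


text \<open>
  For finite graphs the maximum and the minimum above are attained.
\<close>

lemma (in fin_digraph) finite_uedges: "finite (uedges G)"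
proof -
  have "uedges G = (\<lambda>(u, v). {u, v}) ` arcs_ends G"
    by (auto simp: uedges_def)
  then show ?thesis
    by (simp add: arcs_ends_def)
qed

lemma (in fin_digraph) alpha_edge_attained:
  shows "\<exists>A. independent_edges G A \<and> card A = alpha_edge G"
    and "independent_edges G B \<Longrightarrow> card B \<le> alpha_edge G"
proof -
  let ?S = "{card A |A. independent_edges G A}"
  have "?S \<subseteq> card ` Pow (uedges G)"
    by (auto simp: independent_edges_def)
  then have fin: "finite ?S"
    by (rule finite_subset) (simp add: finite_uedges)
  have "independent_edges G {}"
    by (simp add: independent_edges_def)
  then have "?S \<noteq> {}" by blast
  from Max_in[OF fin this] show "\<exists>A. independent_edges G A \<and> card A = alpha_edge G"
    by (auto simp: alpha_edge_def)
  show "independent_edges G B \<Longrightarrow> card B \<le> alpha_edge G"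
    unfolding alpha_edge_def by (rule Max_ge[OF fin]) blast
qed

lemma (in graph) edge_clique_covering_exists:
  "\<exists>C. finite C \<and> edge_clique_covering G C"
proof -
  let ?C = "(\<lambda>e. G \<restriction> e) ` uedges G"
  have sub: "complete_subgraph (G \<restriction> e) G" "e \<in> uedges (G \<restriction> e)" if e: "e \<in> uedges G" for e
  proof -
    from e obtain u v where uv: "e = {u, v}" "u \<rightarrow>\<^bsub>G\<^esub> v"
      by (auto simp: uedges_def)
    from uv(2) have vu: "v \<rightarrow>\<^bsub>G\<^esub> u"
      using sym_arcs unfolding symmetric_def by (rule symD[rotated])
    from uv have in_verts: "e \<subseteq> verts G"
      by (simp add: adj_in_verts)
    from uv(2) have ne: "u \<noteq> v"
      using adj_not_same by blast
    have ends: "arcs_ends (G \<restriction> e) = {(x, y). (x, y) \<in> arcs_ends G \<and> x \<in> e \<and> y \<in> e}"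
      by (auto simp: arcs_ends_def arc_to_ends_def)
    have ind: "induced_subgraph (G \<restriction> e) G"
      using in_verts by (rule induced_induce)
    have gr: "graph (G \<restriction> e)"
      by (intro graph.intro pseudo_graph.intro digraphI_induced[OF ind]
          digraph.axioms(1)[OF digraphI_induced[OF ind]] induced_graph_imp_graph[OF ind])
    have "arcs_ends (G \<restriction> e) = {(x, y). (x, y) \<in> e \<times> e \<and> x \<noteq> y}"
      unfolding ends using uv vu ne adj_not_same by blast
    with ind gr show "complete_subgraph (G \<restriction> e) G"
      by (simp add: complete_subgraph_def complete_digraph_def induced_imp_subgraph)
    show "e \<in> uedges (G \<restriction> e)"
      unfolding uedges_def ends using uv by auto
  qed
  have "edge_clique_covering G ?C"
    using sub by (auto simp: edge_clique_covering_def)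
  then show ?thesis
    using finite_uedges by blast
qed

lemma (in graph) theta_edge_attained:
  shows "\<exists>C. finite C \<and> card C = theta_edge G \<and> edge_clique_covering G C"
    and "finite D \<Longrightarrow> edge_clique_covering G D \<Longrightarrow> theta_edge G \<le> card D"
proof -
  let ?P = "\<lambda>n. \<exists>C. finite C \<and> card C = n \<and> edge_clique_covering G C"
  from edge_clique_covering_exists have "\<exists>n. ?P n" by blast
  then show "?P (theta_edge G)"
    unfolding theta_edge_def by (rule LeastI_ex)
  show "finite D \<Longrightarrow> edge_clique_covering G D \<Longrightarrow> theta_edge G \<le> card D"
    unfolding theta_edge_def by (rule Least_le) blast
qed

end

theory Submission
  imports Defs
begin

text \<open>
  Without an induced \<open>C\<^sub>4\<close> or \<open>P\<^sub>4\<close>, the closed neighbourhoods of adjacent vertices are comparable.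
  Hence, among the common neighbours of the ends of an edge (the ends included), a vertex whose
  closed neighbourhood is smallest is simplicial, so the cliques \<open>N[v]\<close> with \<open>v\<close> simplicial and not
  isolated cover all edges. Choosing for each of them one edge at such a vertex \<open>v\<close> gives an
  independent set, since \<open>N[v]\<close> is the only maximal clique through \<open>v\<close>.
\<close>

definition closed_neighbourhood :: "('a, 'b) pre_digraph \<Rightarrow> 'a \<Rightarrow> 'a set" where
  "closed_neighbourhood G v = insert v {w. v \<rightarrow>\<^bsub>G\<^esub> w}"

definition clique :: "('a, 'b) pre_digraph \<Rightarrow> 'a set \<Rightarrow> bool" where
  "clique G K \<longleftrightarrow> K \<subseteq> verts G \<and> (\<forall>u\<in>K. \<forall>v\<in>K. u \<noteq> v \<longrightarrow> u \<rightarrow>\<^bsub>G\<^esub> v)"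

text \<open>Collecting the sets N[v] rather than the vertices \<open>v\<close> counts simplicial
  vertices with equal closed neighbourhoods once. The neighbour \<open>w\<close> ensures that each
  of these cliques contains an edge.\<close>

definition simplicial_cliques :: "('a, 'b) pre_digraph \<Rightarrow> 'a set set" where
  "simplicial_cliques G =
     {closed_neighbourhood G v |v. clique G (closed_neighbourhood G v) \<and> (\<exists>w. v \<rightarrow>\<^bsub>G\<^esub> w)}"

section \<open>Forbidden induced subgraphs and nested neighbourhoods\<close>

text \<open>Without parallel arcs an arc is determined by its ends, so an embedding given on
  vertices alone extends to arcs in exactly one way.\<close>

lemma (in nomulti_digraph) contains_inducedI:
  assumes inj: "inj_on f (pverts F)"
    and f: "f ` pverts F \<subseteq> verts G"
    and F: "parcs F \<subseteq> pverts F \<times> pverts F"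
    and adj: "\<And>i j. i \<in> pverts F \<Longrightarrow> j \<in> pverts F \<Longrightarrow> f i \<rightarrow>\<^bsub>G\<^esub> f j \<longleftrightarrow> (i, j) \<in> parcs F"
  shows "contains_induced G (with_proj F)"
proof -
  let ?H = "G \<restriction> (f ` pverts F)"
  define g where "g = the_inv_into (pverts F) f"
  have gf [simp]: "g (f i) = i" if "i \<in> pverts F" for i
    using inj that by (simp add: g_def the_inv_into_f_f)
  \<comment> \<open>The isomorphism runs from the induced subgraph to \<open>F\<close>, hence the
    inverse \<open>g\<close> of \<open>f\<close>. Arcs of \<open>with_proj F\<close> are pairs of
    vertices, with \<open>fst\<close> as tail and \<open>snd\<close> as head.\<close>
  define hom where "hom = \<lparr>iso_verts = g, iso_arcs = (\<lambda>e. (g (tail G e), g (head G e))),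
    iso_head = snd, iso_tail = fst\<rparr>"
  have "inj_on g (f ` pverts F)"
    by (auto intro!: inj_onI)
  moreover have "inj_on (iso_arcs hom) (arcs ?H)"
    by (rule inj_onI) (auto simp: hom_def arc_to_ends_def intro!: no_multi_arcs)
  ultimately have "pre_digraph.digraph_isomorphism ?H hom"
    using wellformed_induce_subgraph[of "f ` pverts F"]
    by (auto simp: pre_digraph.digraph_isomorphism_def hom_def)
  moreover have "with_proj F = app_iso hom ?H"
  proof -
    have "(i, j) \<in> iso_arcs hom ` arcs ?H" if ij: "(i, j) \<in> parcs F" for i j
    proof -
      from ij F have i: "i \<in> pverts F" "j \<in> pverts F" by auto
      with ij adj have "f i \<rightarrow>\<^bsub>G\<^esub> f j" by simp
      then obtain e where "e \<in> arcs G" "tail G e = f i" "head G e = f j" by blast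
      with i show ?thesis by (intro rev_image_eqI[of e]) (auto simp: hom_def)
    qed
    moreover have "(i, j) \<in> parcs F" if "(i, j) \<in> iso_arcs hom ` arcs ?H" for i j
    proof -
      from that obtain e where e: "e \<in> arcs ?H" "i = g (tail G e)" "j = g (head G e)"
        by (auto simp: hom_def)
      then obtain k l where kl: "k \<in> pverts F" "tail G e = f k" "l \<in> pverts F" "head G e = f l"
        by auto
      with e have "f k \<rightarrow>\<^bsub>G\<^esub> f l" by (auto intro: dominatesI simp: arc_to_ends_def)
      with adj kl e show ?thesis by simp
    qed
    ultimately have "parcs F = iso_arcs hom ` arcs ?H"
      by (intro equalityI subrelI)
    moreover have "pverts F = g ` f ` pverts F" by (force simp: image_image)
    ultimately show ?thesis
      by (simp add: with_proj_def app_iso_def hom_def)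
  qed
  ultimately show ?thesis
    unfolding contains_induced_def digraph_iso_def using induced_induce[OF f] by blast
qed

text \<open>Otherwise \<open>u\<close> has a neighbour \<open>x\<close> outside N[v] and
  \<open>v\<close> a neighbour \<open>y\<close> outside N[u]. In \<open>x\<close>, \<open>u\<close>,
  \<open>v\<close>, \<open>y\<close> only the adjacency of \<open>x\<close> and \<open>y\<close> is
  open: if adjacent, they close an induced 4-cycle, if not, they end an induced path.\<close>

lemma (in graph) closed_neighbourhoods_comparable:
  assumes tp: "trivially_perfect G" and uv: "u \<rightarrow>\<^bsub>G\<^esub> v"
  shows "closed_neighbourhood G u \<subseteq> closed_neighbourhood G v \<or>
    closed_neighbourhood G v \<subseteq> closed_neighbourhood G u"
proof (rule ccontr)
  assume "\<not> ?thesis"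
  then obtain x y where x: "u \<rightarrow>\<^bsub>G\<^esub> x" "\<not> v \<rightarrow>\<^bsub>G\<^esub> x" "x \<noteq> v" and y: "v \<rightarrow>\<^bsub>G\<^esub> y" "\<not> u \<rightarrow>\<^bsub>G\<^esub> y" "y \<noteq> u"
    using uv graph_symmetric[OF uv] by (auto simp: closed_neighbourhood_def)
  have sym: "a \<rightarrow>\<^bsub>G\<^esub> b \<longleftrightarrow> b \<rightarrow>\<^bsub>G\<^esub> a" for a b using graph_symmetric by blast
  have irr: "\<not> a \<rightarrow>\<^bsub>G\<^esub> a" for a using adj_not_same by blast
  \<comment> \<open>Listed in path order, the same map serves both cases:
    \<open>cycle_graph 4\<close> and \<open>path_graph 4\<close> differ only in the pair of indices
    0 and 3.\<close>
  define f where "f = (!) [x, u, v, y]"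
  have f: "f 0 = x" "f (Suc 0) = u" "f 2 = v" "f 3 = y"
    by (simp_all add: f_def)
  have four: "{..<4} = {0, Suc 0, 2, 3::nat}" by auto
  have inj: "inj_on f {..<4}"
    unfolding four using f x y uv irr by auto
  have sub: "f ` {..<4} \<subseteq> verts G"
    unfolding four using f x y uv adj_in_verts by auto
  have adj: "x \<rightarrow>\<^bsub>G\<^esub> u" "u \<rightarrow>\<^bsub>G\<^esub> x" "v \<rightarrow>\<^bsub>G\<^esub> u" "u \<rightarrow>\<^bsub>G\<^esub> v" "v \<rightarrow>\<^bsub>G\<^esub> y" "y \<rightarrow>\<^bsub>G\<^esub> v"
      "\<not> x \<rightarrow>\<^bsub>G\<^esub> v" "\<not> v \<rightarrow>\<^bsub>G\<^esub> x" "\<not> u \<rightarrow>\<^bsub>G\<^esub> y" "\<not> y \<rightarrow>\<^bsub>G\<^esub> u"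
    using x y uv sym by blast+
  show False
  proof (cases "x \<rightarrow>\<^bsub>G\<^esub> y")
    case True
    then have yx: "y \<rightarrow>\<^bsub>G\<^esub> x" using sym by blast
    have "contains_induced G (with_proj (cycle_graph 4))"
    proof (rule contains_inducedI)
      fix i j assume "i \<in> pverts (cycle_graph 4)" "j \<in> pverts (cycle_graph 4)"
      then have "i \<in> {0, Suc 0, 2, 3}" "j \<in> {0, Suc 0, 2, 3}"
        by (simp_all only: cycle_graph_def pair_pre_digraph.simps four)
      then show "f i \<rightarrow>\<^bsub>G\<^esub> f j \<longleftrightarrow> (i, j) \<in> parcs (cycle_graph 4)"
        using f adj irr True yx by (auto simp: cycle_graph_def)
    qed (use inj sub in \<open>auto simp: cycle_graph_def\<close>)
    with tp show False by (simp add: trivially_perfect_def)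
  next
    case False
    then have yx: "\<not> y \<rightarrow>\<^bsub>G\<^esub> x" using sym by blast
    have "contains_induced G (with_proj (path_graph 4))"
    proof (rule contains_inducedI)
      fix i j assume "i \<in> pverts (path_graph 4)" "j \<in> pverts (path_graph 4)"
      then have "i \<in> {0, Suc 0, 2, 3}" "j \<in> {0, Suc 0, 2, 3}"
        by (simp_all only: path_graph_def pair_pre_digraph.simps four)
      then show "f i \<rightarrow>\<^bsub>G\<^esub> f j \<longleftrightarrow> (i, j) \<in> parcs (path_graph 4)"
        using f adj irr False yx by (auto simp: path_graph_def)
    qed (use inj sub in \<open>auto simp: path_graph_def\<close>)
    with tp show False by (simp add: trivially_perfect_def)
  qed
qed

section \<open>Complete subgraphs as vertex sets\<close>

lemma complete_subgraph_imp_clique: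
  assumes "complete_subgraph H G"
  shows "clique G (verts H)"
proof -
  from assms have sub: "subgraph H G"
    and H: "arcs_ends H = {(u, v). (u, v) \<in> verts H \<times> verts H \<and> u \<noteq> v}"
    by (simp_all add: complete_subgraph_def complete_digraph_def)
  from sub have "arcs_ends H \<subseteq> arcs_ends G"
    by (auto simp: subgraph_def compatible_def arcs_ends_conv)
  with sub H show ?thesis by (auto simp: clique_def subgraph_def)
qed

lemma (in graph) complete_subgraph_induce:
  assumes "clique G K"
  shows "complete_subgraph (G \<restriction> K) G"
proof -
  from assms have ind: "induced_subgraph (G \<restriction> K) G"
    by (intro induced_induce) (simp add: clique_def)
  have "graph (G \<restriction> K)"
    using digraphI_induced[OF ind] induced_graph_imp_graph[OF ind]
    by (intro graph.intro pseudo_graph.intro digraph.axioms(1))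
  moreover have "arcs_ends (G \<restriction> K) = {(u, v). (u, v) \<in> K \<times> K \<and> u \<noteq> v}"
  proof -
    have "arcs_ends (G \<restriction> K) = {(u, v). u \<rightarrow>\<^bsub>G\<^esub> v \<and> u \<in> K \<and> v \<in> K}"
      by (auto simp: arcs_ends_conv)
    with assms adj_not_same show ?thesis by (auto simp: clique_def)
  qed
  ultimately show ?thesis
    using ind by (simp add: complete_subgraph_def complete_digraph_def induced_imp_subgraph)
qed

lemma (in wf_digraph) uedges_subset_verts: "e \<in> uedges G \<Longrightarrow> e \<subseteq> verts G"
  by (auto simp: uedges_def adj_in_verts)

lemma complete_subgraph_uedges_subset:
  assumes "complete_subgraph H G" "e \<in> uedges H"
  shows "e \<subseteq> verts H"
  using assms wf_digraph.uedges_subset_verts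
  by (auto simp: complete_subgraph_def subgraph_def)

lemma uedges_induce:
  assumes "e \<in> uedges G" "e \<subseteq> K"
  shows "e \<in> uedges (G \<restriction> K)"
proof -
  from assms obtain u v where e: "e = {u, v}" "u \<rightarrow>\<^bsub>G\<^esub> v" by (auto simp: uedges_def)
  with assms(2) have "u \<rightarrow>\<^bsub>G \<restriction> K\<^esub> v" by (auto simp: arcs_ends_conv)
  with e show ?thesis by (auto simp: uedges_def)
qed

lemma clique_subset_closed_neighbourhood:
  "clique G K \<Longrightarrow> v \<in> K \<Longrightarrow> K \<subseteq> closed_neighbourhood G v"
  by (auto simp: clique_def closed_neighbourhood_def)

section \<open>Covering the edges by simplicial cliques\<close>

lemma (in graph) simplicial_cliques_cover:
  assumes tp: "trivially_perfect G" and e: "e \<in> uedges G"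
  shows "\<exists>K\<in>simplicial_cliques G. e \<subseteq> K"
proof -
  let ?N = "closed_neighbourhood G"
  have sym: "a \<in> ?N b \<longleftrightarrow> b \<in> ?N a" for a b
    using graph_symmetric by (auto simp: closed_neighbourhood_def)
  have refl: "a \<in> ?N a" for a by (simp add: closed_neighbourhood_def)
  have comparable: "?N a \<subseteq> ?N b \<or> ?N b \<subseteq> ?N a" if "b \<in> ?N a" for a b
    using closed_neighbourhoods_comparable[OF tp, of a b] that
    by (auto simp: closed_neighbourhood_def)
  \<comment> \<open>The ends are named so that the common part of their closed neighbourhoods is
    just \<open>?N u\<close>; the minimum is then taken over \<open>?N u\<close>.\<close>
  from e obtain u v where uv: "e = {u, v}" "u \<rightarrow>\<^bsub>G\<^esub> v" "u \<noteq> v" "?N u \<subseteq> ?N v"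
  proof -
    from e obtain u v where uv: "e = {u, v}" "u \<rightarrow>\<^bsub>G\<^esub> v" by (auto simp: uedges_def)
    then have "u \<noteq> v" "v \<rightarrow>\<^bsub>G\<^esub> u" using adj_not_same graph_symmetric by auto
    with closed_neighbourhoods_comparable[OF tp uv(2)] uv that[of u v] that[of v u]
    show ?thesis by (auto simp: insert_commute)
  qed
  have fin: "finite (?N a)" if "a \<in> verts G" for a
    by (rule finite_subset[OF _ finite_verts])
      (auto simp: closed_neighbourhood_def adj_in_verts that)
  have verts: "?N a \<subseteq> verts G" if "a \<in> verts G" for a
    using that by (auto simp: closed_neighbourhood_def adj_in_verts)
  have u_verts: "u \<in> verts G" using uv adj_in_verts by blast
  obtain w where w: "w \<in> ?N u" and min: "\<And>x. x \<in> ?N u \<Longrightarrow> card (?N w) \<le> card (?N x)"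
    using ex_has_least_nat[of "\<lambda>x. x \<in> ?N u" u "\<lambda>x. card (?N x)"] refl[of u] by auto
  \<comment> \<open>Comparability upgrades minimal cardinality to inclusion: if instead
    \<open>?N x\<close> lies in \<open>?N w\<close>, it cannot be smaller, so the two are
    equal.\<close>
  have w_min: "?N w \<subseteq> ?N x" if x: "x \<in> ?N w" "x \<in> ?N u" for x
  proof -
    have "?N x = ?N w" if "?N x \<subseteq> ?N w"
      using card_seteq[OF fin that] min[OF x(2)] verts[OF u_verts] w by blast
    then show ?thesis using comparable[OF x(1)] by blast
  qed
  \<comment> \<open>From here on every \<open>x\<close> in \<open>?N w\<close> also lies in
    \<open>?N u\<close>, so \<open>w_min\<close> applies to all of \<open>?N w\<close>. For
    \<open>a\<close> and \<open>b\<close> in \<open>?N w\<close> it gives that \<open>b\<close> lies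
    in \<open>?N a\<close>.\<close>
  have wu: "?N w \<subseteq> ?N u" using w_min[of u] w sym refl by blast
  have "clique G (?N w)"
    unfolding clique_def
  proof (intro conjI ballI impI)
    show "?N w \<subseteq> verts G" using wu verts[OF u_verts] by blast
    fix a b assume "a \<in> ?N w" "b \<in> ?N w" "a \<noteq> b"
    with w_min[of a] wu show "a \<rightarrow>\<^bsub>G\<^esub> b" by (auto simp: closed_neighbourhood_def)
  qed
  moreover have "e \<subseteq> ?N w" using w uv sym by blast
  \<comment> \<open>Since \<open>u\<close> and \<open>v\<close> are distinct members of
    \<open>?N w\<close>, at least one of them differs from \<open>w\<close>.\<close>
  moreover from this uv have "\<exists>x. w \<rightarrow>\<^bsub>G\<^esub> x" by (auto simp: closed_neighbourhood_def)
  ultimately show ?thesis by (auto simp: simplicial_cliques_def)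
qed

lemma (in graph) finite_simplicial_cliques: "finite (simplicial_cliques G)"
  by (rule finite_subset[of _ "Pow (verts G)"]) (auto simp: simplicial_cliques_def clique_def)

lemma (in graph) theta_edge_le_simplicial_cliques:
  assumes "trivially_perfect G"
  shows "theta_edge G \<le> card (simplicial_cliques G)"
proof -
  let ?C = "(\<restriction>) G ` simplicial_cliques G"
  have "edge_clique_covering G ?C"
    unfolding edge_clique_covering_def
  proof (intro conjI ballI)
    fix H assume "H \<in> ?C"
    then show "complete_subgraph H G"
      by (auto simp: simplicial_cliques_def intro: complete_subgraph_induce)
  next
    fix e assume e: "e \<in> uedges G"
    then obtain K where "K \<in> simplicial_cliques G" "e \<subseteq> K"
      using simplicial_cliques_cover[OF assms] by blast
    with uedges_induce[OF e] show "\<exists>H\<in>?C. e \<in> uedges H" by blast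
  qed
  then have "theta_edge G \<le> card ?C"
    using finite_simplicial_cliques by (intro theta_edge_attained) simp
  also have "\<dots> \<le> card (simplicial_cliques G)"
    using finite_simplicial_cliques by (rule card_image_le)
  finally show ?thesis .
qed

section \<open>Independent edges and cliques\<close>

lemma (in graph) simplicial_cliques_le_alpha_edge:
  "card (simplicial_cliques G) \<le> alpha_edge G"
proof -
  let ?N = "closed_neighbourhood G"
  have "\<forall>K\<in>simplicial_cliques G. \<exists>v w. K = ?N v \<and> v \<rightarrow>\<^bsub>G\<^esub> w"
    by (auto simp: simplicial_cliques_def)
  then obtain v w where vw: "K = ?N (v K)" "v K \<rightarrow>\<^bsub>G\<^esub> w K" if "K \<in> simplicial_cliques G" for K
    by metis
  define e where "e K = {v K, w K}" for K
  have clique: "clique G K" if "K \<in> simplicial_cliques G" for K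
    using that by (auto simp: simplicial_cliques_def)
  \<comment> \<open>The clique \<open>Q\<close> contains \<open>v K\<close> and \<open>v L\<close>,
    so \<open>v L\<close> lies in \<open>?N (v K)\<close>, which is \<open>K\<close>. Then
    \<open>K\<close> is a clique through \<open>v L\<close> and lies in \<open>?N (v L)\<close>,
    which is \<open>L\<close>; the converse is symmetric.\<close>
  have eq: "K = L"
    if K: "K \<in> simplicial_cliques G" and L: "L \<in> simplicial_cliques G"
      and Q: "clique G Q" "e K \<subseteq> Q" "e L \<subseteq> Q" for K L Q
  proof -
    have "v L \<in> K" "v K \<in> L"
      using clique_subset_closed_neighbourhood[OF Q(1)] vw(1)[OF K] vw(1)[OF L] Q(2,3)
      unfolding e_def by blast+
    then have "K \<subseteq> ?N (v L)" "L \<subseteq> ?N (v K)"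
      using clique_subset_closed_neighbourhood[OF clique] K L by simp_all
    then show "K = L" using vw(1)[OF K] vw(1)[OF L] by blast
  qed
  have e_subset: "e K \<subseteq> K" if "K \<in> simplicial_cliques G" for K
    using vw[OF that] by (auto simp: e_def closed_neighbourhood_def)
  \<comment> \<open>If \<open>e K\<close> and \<open>e L\<close> coincide, \<open>K\<close> itself
    serves as the clique \<open>Q\<close> in \<open>eq\<close>.\<close>
  have inj: "inj_on e (simplicial_cliques G)"
    using eq clique e_subset by (intro inj_onI) metis
  have "independent_edges G (e ` simplicial_cliques G)"
    unfolding independent_edges_def
  proof (intro conjI ballI impI notI)
    show "e ` simplicial_cliques G \<subseteq> uedges G"
      using vw(2) by (auto simp: uedges_def e_def)
    fix a b
    assume "a \<in> e ` simplicial_cliques G" "b \<in> e ` simplicial_cliques G" "a \<noteq> b"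
      and "\<exists>H. complete_subgraph H G \<and> a \<in> uedges H \<and> b \<in> uedges H"
    then show False
      using eq complete_subgraph_imp_clique complete_subgraph_uedges_subset by blast
  qed
  then have "card (e ` simplicial_cliques G) \<le> alpha_edge G"
    by (rule alpha_edge_attained)
  with inj show ?thesis by (simp add: card_image)
qed

text \<open>A member of a covering contains at most one edge of an independent set, so sending each
  such edge to a member containing it is injective.\<close>

lemma (in graph) alpha_edge_le_theta_edge: "alpha_edge G \<le> theta_edge G"
proof -
  obtain A where A: "independent_edges G A" "card A = alpha_edge G"
    using alpha_edge_attained by blast
  obtain C where C: "finite C" "card C = theta_edge G" "edge_clique_covering G C"
    using theta_edge_attained by blast
  have "\<forall>e\<in>A. \<exists>H\<in>C. complete_subgraph H G \<and> e \<in> uedges H"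
    using A C unfolding independent_edges_def edge_clique_covering_def by blast
  then obtain h where h: "h e \<in> C" "complete_subgraph (h e) G" "e \<in> uedges (h e)" if "e \<in> A" for e
    by metis
  have "inj_on h A"
    using A(1) h unfolding independent_edges_def by (intro inj_onI) metis
  then have "card A \<le> card C"
    using h(1) C(1) by (intro card_inj_on_le[of h]) auto
  with A C show ?thesis by simp
qed

theorem theorem8:
  fixes G :: "('a, 'b) pre_digraph"
  assumes "graph G"
    and "connected G"
    and "trivially_perfect G"
  shows "alpha_edge G = theta_edge G"
proof -
  interpret graph G by fact
  \<comment> \<open>The number of simplicial cliques is squeezed between \<open>theta_edge G\<close>
    below and \<open>alpha_edge G\<close> above, and \<open>alpha_edge G\<close> is at most
    \<open>theta_edge G\<close>.\<close>
  show ?thesis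
    using theta_edge_le_simplicial_cliques[OF assms(3)] simplicial_cliques_le_alpha_edge
      alpha_edge_le_theta_edge by simp
qed

end
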